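(* Let $p>3$ be a prime and $a$ a rational number whose denominator is not divisible by $p$, with $\big(\frac{a(4-27a)}p\big)=-1$. Then $x\equiv\sum_{k=0}^{[p/3]}\binom{3k}k a^k\pmod p$ is the unique solution of the cubic congruence $(27a-4)x^3+3x+1\equiv0\pmod p$.
   Context: $[x]$ denotes the greatest integer not exceeding $x$. For a rational number $r$ whose denominator is prime to $p$, $\big(\frac rp\big)$ is the Legendre symbol of the residue of $r$ modulo $p$, and congruences mod $p$ are taken in the ring of such rationals. *)

theory Defs
  imports "HOL-Number_Theory.Number_Theory"
begin

definition p_integers :: "nat \<Rightarrow> rat set" where
  "p_integers p = {r. \<not> int p dvd snd (quotient_of r)}"

definition p_cong :: "nat \<Rightarrow> rat \<Rightarrow> rat \<Rightarrow> bool" where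
  "p_cong p x y \<longleftrightarrow>
     x \<in> p_integers p \<and> y \<in> p_integers p \<and> (\<exists>t\<in>p_integers p. x - y = of_nat p * t)"

definition p_residue :: "nat \<Rightarrow> rat \<Rightarrow> int" where
  "p_residue p r = (THE m. 0 \<le> m \<and> m < int p \<and> p_cong p r (of_int m))"

definition rat_Legendre :: "rat \<Rightarrow> nat \<Rightarrow> int" where
  "rat_Legendre r p = Legendre (p_residue p r) (int p)"

lemma p_integers_iff:
  "x \<in> p_integers p \<longleftrightarrow> (\<exists>n d. \<not> int p dvd d \<and> x = of_int n / of_int d)"
proof
  assume "x \<in> p_integers p"
  moreover have "x = of_int (fst (quotient_of x)) / of_int (snd (quotient_of x))"
    by (rule quotient_of_div) simp
  ultimately show "\<exists>n d. \<not> int p dvd d \<and> x = of_int n / of_int d"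
    unfolding p_integers_def by blast
next
  assume "\<exists>n d. \<not> int p dvd d \<and> x = of_int n / of_int d"
  then obtain n d where d: "\<not> int p dvd d" and x: "x = of_int n / of_int d" by blast
  obtain n' d' where q: "quotient_of x = (n', d')" by fastforce
  have d'0: "d' > 0" using quotient_of_denom_pos[OF q] .
  have d0: "d \<noteq> 0" using d by auto
  have "of_int n / of_int d = (of_int n' / of_int d' :: rat)"
    using quotient_of_div[OF q] x by simp
  then have "(of_int (n * d') :: rat) = of_int (n' * d)"
    using d0 d'0 by (simp add: field_simps)
  then have "n * d' = n' * d" by (simp only: of_int_eq_iff)
  then have "d' dvd n' * d" by (metis dvd_triv_right)
  moreover have "coprime d' n'"
    using quotient_of_coprime[OF q] by (simp add: coprime_commute)
  ultimately have "d' dvd d" by (simp add: coprime_dvd_mult_right_iff)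
  then show "x \<in> p_integers p" using d q dvd_trans unfolding p_integers_def by fastforce
qed

lemma p_residue_well_defined:
  assumes p: "prime p" and r: "r \<in> p_integers p"
  shows "\<exists>!m. 0 \<le> m \<and> m < int p \<and> p_cong p r (of_int m)"
proof -
  have pp: "prime (int p)" using p by simp
  obtain n d where d: "\<not> int p dvd d" and rnd: "r = of_int n / of_int d"
    using r p_integers_iff by blast
  have d0: "d \<noteq> 0" using d by auto
  have int_in: "of_int k \<in> p_integers p" for k
    unfolding p_integers_iff using prime_gt_1_nat[OF p]
    by (intro exI[of _ k] exI[of _ 1]) auto
  have key: "p_cong p r (of_int m) \<longleftrightarrow> [d * m = n] (mod int p)" for m
  proof
    assume "p_cong p r (of_int m)"
    then obtain t where t: "t \<in> p_integers p" "r - of_int m = of_nat p * t"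
      unfolding p_cong_def by blast
    then obtain k e where e: "\<not> int p dvd e" "t = of_int k / of_int e"
      using p_integers_iff by blast
    have e0: "e \<noteq> 0" using e by auto
    have "(of_int n / of_int d - of_int m :: rat) = of_nat p * (of_int k / of_int e)"
      using t e rnd by simp
    then have "(of_int ((n - d * m) * e) :: rat) = of_int (int p * k * d)"
      using d0 e0 by (simp add: field_simps)
    then have "(n - d * m) * e = int p * k * d" by (simp only: of_int_eq_iff)
    then have "int p dvd (n - d * m) * e" by simp
    then have "int p dvd n - d * m" using e(1) pp prime_dvd_multD by blast
    then show "[d * m = n] (mod int p)" by (metis cong_iff_dvd_diff cong_sym)
  next
    assume "[d * m = n] (mod int p)"
    then have "int p dvd n - d * m" by (metis cong_iff_dvd_diff cong_sym)
    then obtain k where k: "n - d * m = int p * k" by blast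
    have "(of_int (n - d * m) :: rat) = of_int (int p * k)" using k by simp
    then have "r - of_int m = of_nat p * (of_int k / of_int d)"
      using d0 rnd by (simp add: field_simps)
    moreover have "of_int k / of_int d \<in> p_integers p" using d p_integers_iff by blast
    ultimately show "p_cong p r (of_int m)" unfolding p_cong_def using r int_in by blast
  qed
  have cop: "coprime d (int p)" using d pp by (metis coprime_commute prime_imp_coprime)
  then obtain u where u: "[d * u = 1] (mod int p)" using cong_solve_coprime_int by blast
  have p0: "int p > 0" using p prime_gt_0_nat by simp
  show ?thesis unfolding key
  proof (rule ex1I[of _ "(u * n) mod int p"])
    have "[d * ((u * n) mod int p) = d * u * n] (mod int p)"
      by (simp add: cong_def mod_mult_right_eq mult.assoc)
    also have "[d * u * n = 1 * n] (mod int p)" using u by (rule cong_scalar_right)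
    finally show "0 \<le> (u * n) mod int p \<and> (u * n) mod int p < int p \<and>
        [d * ((u * n) mod int p) = n] (mod int p)" using p0 by simp
    fix m assume m: "0 \<le> m \<and> m < int p \<and> [d * m = n] (mod int p)"
    then have "[d * m = d * ((u * n) mod int p)] (mod int p)"
      using \<open>0 \<le> (u * n) mod int p \<and> _\<close> cong_trans cong_sym by blast
    then have "[m = (u * n) mod int p] (mod int p)" using cop cong_mult_lcancel by blast
    then show "m = (u * n) mod int p" using m p0 by (simp add: cong_def)
  qed
qed

end

theory Submission
  imports Defs
begin

text \<open>
  Put \<open>n = p div 3\<close>. Since \<open>3 n \<equiv> -1\<close> or \<open>-2\<close> modulo \<open>p\<close>, the coefficient \<open>binomial(3k, k)\<close> is
  congruent to \<open>(-27)^k binomial(n + k, 2k)\<close>, so the sum is congruent to the Chebyshev polynomial of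
  the third kind \<open>V\<^sub>n(cos 2\<theta>) = cos((2n + 1)\<theta>) / cos \<theta>\<close> at \<open>cos 2\<theta> = 1 - 27a/2\<close>.
  The triple angle formula gives \<open>(4 - 27a) V\<^sub>n\<^sup>3 - 3 V\<^sub>n = V\<^sub>3\<^sub>n\<^sub>+\<^sub>1\<close>, where \<open>3n + 1\<close> is \<open>p\<close> or \<open>p - 1\<close>.
  The Frobenius map evaluates \<open>V\<^sub>3\<^sub>n\<^sub>+\<^sub>1\<close> as 1: the relevant quadratic character is that of
  \<open>-3 a (4 - 27a)\<close>, which by quadratic reciprocity is the negative of the symbol of \<open>p\<close> modulo 3.
  A second root is impossible, since the discriminant \<open>27\<^sup>2 a (4 - 27a)\<close> of the cubic would then
  be a square modulo \<open>p\<close>.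
\<close>

section \<open>Powers in a quadratic ring\<close>

text \<open>\<open>(y + \<surd>D) ^ m = quad_re y D m + quad_im y D m * \<surd>D\<close>\<close>

fun quad_re quad_im :: "int \<Rightarrow> int \<Rightarrow> nat \<Rightarrow> int" where
  "quad_re y D 0 = 1"
| "quad_re y D (Suc m) = y * quad_re y D m + D * quad_im y D m"
| "quad_im y D 0 = 0"
| "quad_im y D (Suc m) = quad_re y D m + y * quad_im y D m"

lemma quad_add:
  "quad_re y D (m + n) = quad_re y D m * quad_re y D n + D * quad_im y D m * quad_im y D n"
  "quad_im y D (m + n) = quad_re y D m * quad_im y D n + quad_im y D m * quad_re y D n"
  by (induction m) (simp_all add: algebra_simps)

text \<open>The norm of y + \<surd>D is y^2 - D = 1, and norms are multiplicative.\<close>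

lemma quad_norm_one:
  assumes "D = y\<^sup>2 - 1"
  shows "(quad_re y D m)\<^sup>2 - D * (quad_im y D m)\<^sup>2 = 1"
proof (induction m)
  case (Suc m)
  then show ?case unfolding quad_re.simps quad_im.simps assms by Groebner_Basis.algebra
qed simp

text \<open>Pascal's rule for an arbitrary sequence \<open>f\<close>; taking \<open>f k\<close> to
  be either coordinate of (\<surd>D)^k serves both halves of \<open>quad_binomial\<close>.\<close>

lemma binomial_transform_Suc:
  fixes y :: "'a :: comm_semiring_1"
  shows "(\<Sum>k\<le>Suc m. of_nat (Suc m choose k) * y ^ (Suc m - k) * f k) =
    y * (\<Sum>k\<le>m. of_nat (m choose k) * y ^ (m - k) * f k) +
    (\<Sum>k\<le>m. of_nat (m choose k) * y ^ (m - k) * f (Suc k))"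
proof -
  have "(\<Sum>k\<le>Suc m. of_nat (Suc m choose k) * y ^ (Suc m - k) * f k) =
    y ^ Suc m * f 0 + (\<Sum>k\<le>m. of_nat (m choose Suc k) * y ^ (m - k) * f (Suc k)) +
    (\<Sum>k\<le>m. of_nat (m choose k) * y ^ (m - k) * f (Suc k))"
    by (subst sum.atMost_Suc_shift) (simp add: algebra_simps sum.distrib)
  also have "y ^ Suc m * f 0 + (\<Sum>k\<le>m. of_nat (m choose Suc k) * y ^ (m - k) * f (Suc k)) =
    (\<Sum>k\<le>Suc m. of_nat (m choose k) * y ^ (Suc m - k) * f k)"
    by (subst sum.atMost_Suc_shift) simp
  also have "\<dots> = (\<Sum>k\<le>m. of_nat (m choose k) * y ^ (Suc m - k) * f k)"
    by (simp add: binomial_eq_0)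
  also have "\<dots> = y * (\<Sum>k\<le>m. of_nat (m choose k) * y ^ (m - k) * f k)"
    unfolding sum_distrib_left by (rule sum.cong) (auto simp: Suc_diff_le algebra_simps)
  finally show ?thesis .
qed

lemma quad_binomial:
  "quad_re y D m = (\<Sum>k\<le>m. of_nat (m choose k) * y ^ (m - k) * (if even k then D ^ (k div 2) else 0))"
  "quad_im y D m = (\<Sum>k\<le>m. of_nat (m choose k) * y ^ (m - k) * (if odd k then D ^ (k div 2) else 0))"
proof (induction m)
  case (Suc m)
  \<comment> \<open>Multiplication by \<surd>D swaps the two coordinates, with a factor
    \<open>D\<close> on the way from the \<surd>D part to the integer part.\<close>
  have D: "(if even (Suc k) then D ^ (Suc k div 2) else 0) = D * (if odd k then D ^ (k div 2) else 0)"
    and E: "(if odd (Suc k) then D ^ (Suc k div 2) else 0) = (if even k then D ^ (k div 2) else 0)"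
    for k
    by (auto elim!: oddE)
  {
    case 1
    show ?case
      unfolding binomial_transform_Suc D quad_re.simps Suc sum_distrib_left
      by (simp add: algebra_simps)
  next
    case 2
    show ?case
      unfolding binomial_transform_Suc E quad_im.simps Suc by simp
  }
qed simp_all

text \<open>\<open>p\<close> divides every inner binomial coefficient, so only the two end terms
  survive.\<close>

lemma binomial_transform_prime_cong:
  fixes y :: int
  assumes "prime p"
  shows "[(\<Sum>k\<le>p. of_nat (p choose k) * y ^ (p - k) * f k) = y ^ p * f 0 + f p] (mod int p)"
proof -
  obtain q where q: "p = Suc q"
    using assms prime_gt_0_nat gr0_implies_Suc by blast
  have inner: "[(\<Sum>k\<in>{1..q}. of_nat (p choose k) * y ^ (p - k) * f k) = (\<Sum>k\<in>{1..q}. 0)] (mod int p)"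
  proof (rule cong_sum)
    fix k assume "k \<in> {1..q}"
    then have "p dvd (p choose k)"
      using assms q by (intro dvd_choose_prime) auto
    then show "[of_nat (p choose k) * y ^ (p - k) * f k = 0] (mod int p)"
      by (simp add: cong_0_iff)
  qed
  have "(\<Sum>k\<le>p. of_nat (p choose k) * y ^ (p - k) * f k) =
    (\<Sum>k\<in>{1..q}. of_nat (p choose k) * y ^ (p - k) * f k) + (y ^ p * f 0 + f p)"
    unfolding q by (simp add: atMost_atLeast0 sum.atLeast_Suc_atMost)
  with cong_add[OF inner cong_refl, of "y ^ p * f 0 + f p"] show ?thesis
    by simp
qed

lemma fermat_int:
  fixes y :: int
  assumes "prime p"
  shows "[y ^ p = y] (mod int p)"
proof (cases "int p dvd y")
  case True
  then have "int p dvd y ^ p"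
    using assms prime_gt_0_nat dvd_power_le by (metis dvd_power dvd_trans)
  with True show ?thesis
    by (simp add: cong_iff_dvd_diff)
next
  case False
  define c where "c = nat (y mod int p)"
  have c: "[int c = y] (mod int p)"
    using assms prime_gt_0_nat by (simp add: c_def cong_def)
  then have "\<not> p dvd c"
    using False by (metis cong_dvd_iff int_dvd_int_iff)
  then have "[c ^ (p - 1) = 1] (mod p)"
    using assms fermat_theorem by blast
  then have "[int c ^ (p - 1) * int c = 1 * int c] (mod int p)"
    by (metis cong_int_iff cong_scalar_right of_nat_1 of_nat_power)
  moreover have "int c ^ (p - 1) * int c = int c ^ p"
    using assms prime_gt_0_nat by (metis Suc_diff_1 power_Suc2)
  ultimately have "[int c ^ p = int c] (mod int p)" by simp
  then show ?thesis
    using c by (meson cong_pow cong_sym cong_trans)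
qed

text \<open>Frobenius: (y + \<surd>D)^p is congruent to y^p + (\<surd>D)^p, where y^p reduces to y
  by Fermat and (\<surd>D)^p = D^((p-1)/2) \<surd>D.\<close>

lemma quad_prime_cong:
  assumes "prime p" "odd p"
  shows "[quad_re y D p = y] (mod int p)" "[quad_im y D p = D ^ ((p - 1) div 2)] (mod int p)"
proof -
  have "[quad_re y D p = y ^ p] (mod int p)"
    using binomial_transform_prime_cong[OF assms(1), of y "\<lambda>k. if even k then D ^ (k div 2) else 0"]
      assms(2) by (simp add: quad_binomial(1))
  then show "[quad_re y D p = y] (mod int p)"
    using fermat_int[OF assms(1)] cong_trans by blast
  show "[quad_im y D p = D ^ ((p - 1) div 2)] (mod int p)"
    using binomial_transform_prime_cong[OF assms(1), of y "\<lambda>k. if odd k then D ^ (k div 2) else 0"]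
      assms(2) by (simp add: quad_binomial(2)) (auto elim!: oddE)
qed

section \<open>Chebyshev polynomials of the third kind\<close>

text \<open>With D = y^2 - 1 the two coordinates are the Chebyshev values T_m(y) and U_{m-1}(y), so
  this is U_m(y) - U_{m-1}(y).\<close>

definition cheb_V :: "int \<Rightarrow> nat \<Rightarrow> int" where
  "cheb_V y m = quad_re y (y\<^sup>2 - 1) m + (y - 1) * quad_im y (y\<^sup>2 - 1) m"

lemma cheb_V_binomial:
  assumes "t = 2 * (y - 1)"
  shows "cheb_V y n = (\<Sum>k\<le>n. of_nat ((n + k) choose (2 * k)) * t ^ k)"
proof -
  define W where "W n = (\<Sum>k\<le>n. of_nat ((n + k) choose (2 * k)) * t ^ k)" for n
  \<comment> \<open>Pascal's rule mixes even and odd lower indices, so the odd companion sum is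
    carried along; it turns out to be U_{n-1}(y).\<close>
  define Z where "Z n = (\<Sum>k\<le>n. of_nat ((n + k) choose (2 * k + 1)) * t ^ k)" for n
  have Z_Suc: "Z (Suc n) = W n + Z n" for n
  proof -
    have "Z (Suc n) = (\<Sum>k\<le>n. of_nat ((Suc n + k) choose (2 * k + 1)) * t ^ k)"
      by (simp add: Z_def binomial_eq_0 del: binomial_Suc_Suc)
    also have "\<dots> = W n + Z n"
      by (simp add: W_def Z_def sum.distrib algebra_simps)
    finally show ?thesis .
  qed
  have W_Suc: "W (Suc n) = W n + t * Z (Suc n)" for n
  proof -
    have *: "(Suc n + Suc k) choose (2 * Suc k) =
      ((n + Suc k) choose (2 * Suc k)) + ((Suc n + k) choose (2 * k + 1))" for k
      by simp
    have "W (Suc n) = 1 + (\<Sum>k\<le>n. of_nat ((Suc n + Suc k) choose (2 * Suc k)) * t ^ Suc k)"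
      unfolding W_def by (subst sum.atMost_Suc_shift) simp
    also have "\<dots> = 1 + (\<Sum>k\<le>n. of_nat ((n + Suc k) choose (2 * Suc k)) * t ^ Suc k) +
        t * (\<Sum>k\<le>n. of_nat ((Suc n + k) choose (2 * k + 1)) * t ^ k)"
      unfolding * by (simp add: sum.distrib sum_distrib_left algebra_simps del: binomial_Suc_Suc)
    also have "1 + (\<Sum>k\<le>n. of_nat ((n + Suc k) choose (2 * Suc k)) * t ^ Suc k) =
        (\<Sum>k\<le>Suc n. of_nat ((n + k) choose (2 * k)) * t ^ k)"
      by (subst sum.atMost_Suc_shift) simp
    also have "\<dots> = W n"
      by (simp add: W_def binomial_eq_0)
    also have "(\<Sum>k\<le>n. of_nat ((Suc n + k) choose (2 * k + 1)) * t ^ k) = Z (Suc n)"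
      by (simp add: Z_def binomial_eq_0 del: binomial_Suc_Suc)
    finally show ?thesis .
  qed
  have "W n = cheb_V y n \<and> Z n = quad_im y (y\<^sup>2 - 1) n"
  proof (induction n)
    case 0
    show ?case by (simp add: W_def Z_def cheb_V_def)
  next
    case (Suc n)
    then show ?case
      unfolding W_Suc Z_Suc assms cheb_V_def quad_re.simps quad_im.simps
      by (simp add: algebra_simps power2_eq_square)
  qed
  then show ?thesis by (simp add: W_def)
qed

text \<open>Divide cos 3\<psi> = 4 cos^3 \<psi> - 3 cos \<psi> at \<psi> = (2n+1)\<theta> by cos
  \<theta>, where y = cos 2\<theta> and 4 cos^2 \<theta> = 2 + 2y. Algebraically, the norm relation
  is all that has to be added to the addition formulas.\<close>

lemma cheb_V_triple:
  "cheb_V y (3 * n + 1) = (2 + 2 * y) * cheb_V y n ^ 3 - 3 * cheb_V y n"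
proof -
  have n: "3 * n + 1 = Suc (n + (n + n))" by simp
  have "(quad_re y (y\<^sup>2 - 1) n)\<^sup>2 - (y\<^sup>2 - 1) * (quad_im y (y\<^sup>2 - 1) n)\<^sup>2 = 1"
    by (rule quad_norm_one) simp
  then show ?thesis
    unfolding n cheb_V_def quad_re.simps quad_im.simps quad_add by Groebner_Basis.algebra
qed

text \<open>By Frobenius the coordinates at index \<open>p\<close> are y and e. For e = -1 this
  gives y - (y - 1) = 1; for e = 1, stepping back one index flips the sign of y - 1 and gives y + (1
  - y) = 1.\<close>

lemma cheb_V_prime:
  assumes "prime p" "odd p" and e: "[(y\<^sup>2 - 1) ^ ((p - 1) div 2) = e] (mod int p)"
  shows "e = -1 \<Longrightarrow> [cheb_V y p = 1] (mod int p)"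
    and "e = 1 \<Longrightarrow> [cheb_V y (p - 1) = 1] (mod int p)"
proof -
  define D where "D = y\<^sup>2 - 1"
  have re: "[quad_re y D p = y] (mod int p)" and im: "[quad_im y D p = e] (mod int p)"
    using quad_prime_cong[OF assms(1,2), of y D] e cong_trans unfolding D_def by blast+
  show "[cheb_V y p = 1] (mod int p)" if "e = -1"
    using cong_add[OF re cong_mult[OF cong_refl im, of "y - 1"]] that
    by (simp add: cheb_V_def D_def)
  have "p = Suc (p - 1)" using assms(1) prime_gt_0_nat by auto
  then have "quad_re y D p = y * quad_re y D (p - 1) + D * quad_im y D (p - 1)"
    and "quad_im y D p = quad_re y D (p - 1) + y * quad_im y D (p - 1)"
    by (metis quad_re.simps(2), metis quad_im.simps(2))
  then have *: "cheb_V y (p - 1) = quad_re y D p + (1 - y) * quad_im y D p"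
    unfolding cheb_V_def D_def[symmetric] by (simp add: D_def algebra_simps power2_eq_square)
  show "[cheb_V y (p - 1) = 1] (mod int p)" if "e = 1"
    using cong_add[OF re cong_mult[OF cong_refl im, of "1 - y"]] that
    by (simp only: * mult_1_right) simp
qed

section \<open>Binomial coefficients and quadratic characters modulo a prime\<close>

text \<open>This lemma and the next give ratios of consecutive coefficients, cross-multiplied; their
  common factor (2k+1)(2k+2) makes the ratios comparable modulo \<open>p\<close>.\<close>

lemma choose_triple_Suc:
  "((3 * Suc k) choose Suc k) * ((2 * k + 1) * (2 * k + 2)) =
   ((3 * k) choose k) * (3 * (3 * k + 1) * (3 * k + 2))"
proof -
  have b: "((3 * k) choose k) * (fact k * fact (2 * k)) = fact (3 * k)" for k :: nat
    using binomial_fact_lemma[of k "3 * k"] by (simp add: algebra_simps)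
  have f2: "fact (2 * Suc k) = (2 * k + 2) * ((2 * k + 1) * fact (2 * k) :: nat)"
    by (simp add: algebra_simps)
  have f3: "fact (3 * Suc k) = (3 * k + 3) * ((3 * k + 2) * ((3 * k + 1) * fact (3 * k)) :: nat)"
    by (simp add: numeral_3_eq_3 algebra_simps)
  have "((3 * Suc k) choose Suc k) * ((2 * k + 1) * (2 * k + 2)) * (Suc k * fact k * fact (2 * k)) =
      ((3 * Suc k) choose Suc k) * (fact (Suc k) * fact (2 * Suc k))"
    unfolding f2 fact_Suc by (simp only: of_nat_id mult_ac)
  also have "\<dots> = (3 * k + 3) * ((3 * k + 2) * ((3 * k + 1) * (((3 * k) choose k) * (fact k * fact (2 * k)))))"
    unfolding b f3 ..
  also have "\<dots> = ((3 * k) choose k) * (3 * (3 * k + 1) * (3 * k + 2)) * (Suc k * fact k * fact (2 * k))"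
    by (simp add: algebra_simps)
  finally show ?thesis
    by (subst (asm) mult_cancel2) simp
qed

lemma choose_shifted_Suc:
  assumes "k < n"
  shows "((n + Suc k) choose (2 * Suc k)) * ((2 * k + 1) * (2 * k + 2)) =
    ((n + k) choose (2 * k)) * ((n + Suc k) * (n - k))"
proof -
  have b: "((n + k) choose (2 * k)) * (fact (2 * k) * fact (n - k)) = fact (n + k)" if "k \<le> n" for k
    using binomial_fact_lemma[of "2 * k" "n + k"] that by (simp add: algebra_simps)
  have f2: "fact (2 * Suc k) = (2 * k + 2) * ((2 * k + 1) * fact (2 * k) :: nat)"
    by (simp add: algebra_simps)
  have f: "fact (n - k) = (n - k) * (fact (n - Suc k) :: nat)"
    using assms by (metis Suc_diff_Suc fact_Suc of_nat_id)
  have "((n + Suc k) choose (2 * Suc k)) * ((2 * k + 1) * (2 * k + 2)) * (fact (2 * k) * fact (n - Suc k)) =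
      ((n + Suc k) choose (2 * Suc k)) * (fact (2 * Suc k) * fact (n - Suc k))"
    unfolding f2 by (simp only: mult_ac)
  also have "\<dots> = (n + Suc k) * (((n + k) choose (2 * k)) * (fact (2 * k) * fact (n - k)))"
    using b[of "Suc k"] b[of k] assms by simp
  also have "\<dots> = ((n + k) choose (2 * k)) * ((n + Suc k) * (n - k)) * (fact (2 * k) * fact (n - Suc k))"
    unfolding f by (simp only: mult_ac)
  finally show ?thesis
    by (subst (asm) mult_cancel2) simp
qed

lemma prime_mod_3:
  assumes "prime p" "p > 3"
  shows "p mod 3 = 1 \<or> p mod 3 = (2 :: nat)"
proof -
  have "\<not> 3 dvd p"
    using assms primes_dvd_imp_eq[of 3 p] by auto
  then show ?thesis by presburger
qed

text \<open>Both sides have congruent ratios of consecutive terms. The bound on \<open>k\<close>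
  keeps 2k+1 and 2k+2 below \<open>p\<close>, so their product can be cancelled.\<close>

lemma choose_triple_cong:
  assumes p: "prime p" "p > 3" and "k \<le> p div 3"
  shows "[int ((3 * k) choose k) = int ((p div 3 + k) choose (2 * k)) * (-27) ^ k] (mod int p)"
  using assms(3)
proof (induction k)
  case (Suc k)
  define n where "n = p div 3"
  define c where "c = int ((2 * k + 1) * (2 * k + 2))"
  have kn: "k < n" using Suc.prems by (simp add: n_def)
  have IH: "[int ((3 * k) choose k) = int ((n + k) choose (2 * k)) * (-27) ^ k] (mod int p)"
    using Suc by (simp add: n_def)
  have small: "\<not> p dvd m" if "0 < m" "m < p" for m
    using that nat_dvd_not_less by blast
  have "\<not> p dvd 2 * k + 1" "\<not> p dvd 2 * k + 2"
    using kn unfolding n_def by (intro small; linarith)+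
  then have "\<not> p dvd (2 * k + 1) * (2 * k + 2)"
    using p(1) prime_dvd_multD by blast
  then have cop: "coprime c (int p)"
    unfolding c_def using p(1)
    by (metis coprime_commute coprime_int_iff prime_imp_coprime)
  \<comment> \<open>Writing n - k as \<open>Suc j\<close> removes the truncated subtraction.\<close>
  obtain j where j: "n = Suc (k + j)"
    using kn less_iff_Suc_add by blast
  have "p = 3 * n + 1 \<or> p = 3 * n + 2"
    using prime_mod_3[OF p] unfolding n_def by presburger
  \<comment> \<open>The difference of the two sides is 3(3n+1)(3n+2), independent of
    \<open>k\<close>, and one of these factors is \<open>p\<close>.\<close>
  then have mid: "[int (3 * (3 * k + 1) * (3 * k + 2)) = int ((n + Suc k) * (n - k)) * (-27)] (mod int p)"
  proof
    assume "p = 3 * n + 1"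
    then have "int (3 * (3 * k + 1) * (3 * k + 2)) - int ((n + Suc k) * (n - k)) * (-27) = int p * (9 * int n + 6)"
      using j by (simp add: algebra_simps)
    then show ?thesis by (simp add: cong_iff_dvd_diff)
  next
    assume "p = 3 * n + 2"
    then have "int (3 * (3 * k + 1) * (3 * k + 2)) - int ((n + Suc k) * (n - k)) * (-27) = int p * (9 * int n + 3)"
      using j by (simp add: algebra_simps)
    then show ?thesis by (simp add: cong_iff_dvd_diff)
  qed
  have "int ((3 * Suc k) choose Suc k) * c = int ((3 * k) choose k) * int (3 * (3 * k + 1) * (3 * k + 2))"
    unfolding c_def by (metis choose_triple_Suc of_nat_mult)
  also have "[\<dots> = (int ((n + k) choose (2 * k)) * (-27) ^ k) * (int ((n + Suc k) * (n - k)) * (-27))] (mod int p)"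
    by (rule cong_mult[OF IH mid])
  also have "(int ((n + k) choose (2 * k)) * (-27) ^ k) * (int ((n + Suc k) * (n - k)) * (-27)) =
      int (((n + k) choose (2 * k)) * ((n + Suc k) * (n - k))) * (-27) ^ Suc k"
    by (simp only: of_nat_mult power_Suc mult_ac)
  also have "\<dots> = (int ((n + Suc k) choose (2 * Suc k)) * (-27) ^ Suc k) * c"
    unfolding choose_shifted_Suc[OF kn, symmetric] c_def by (simp only: of_nat_mult mult_ac)
  finally show ?case
    using cop cong_mult_rcancel unfolding n_def by blast
qed simp

text \<open>The sign (-1)^h from reciprocity between \<open>p\<close> and 3 is absorbed into (-3)^h,
  so Euler's criterion for 3 yields the symbol of \<open>p\<close> modulo 3.\<close>

lemma minus_three_euler:
  assumes p: "prime p" "p > 3"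
  shows "[(-3) ^ ((p - 1) div 2) = (if p mod 3 = 1 then 1 else -1 :: int)] (mod int p)"
proof -
  define h where "h = (p - 1) div 2"
  note p3 = prime_mod_3[OF p]
  have L3: "Legendre (int p) 3 = (if p mod 3 = 1 then 1 else -1)"
  proof (cases "p mod 3 = 1")
    case True
    then have "int p mod 3 = 1" by presburger
    then have "[1\<^sup>2 = int p] (mod 3)" "\<not> [int p = 0] (mod 3)" by (simp_all add: cong_def)
    then show ?thesis using True unfolding Legendre_def QuadRes_def by metis
  next
    case False
    then have m: "int p mod 3 = 2" using p3 by presburger
    have "\<not> [z\<^sup>2 = int p] (mod 3)" for z
    proof -
      have "z mod 3 = 0 \<or> z mod 3 = 1 \<or> z mod 3 = 2" by presburger
      then have "(z mod 3)\<^sup>2 mod 3 \<noteq> 2" by auto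
      then show ?thesis using m by (simp add: cong_def power_mod)
    qed
    moreover have "\<not> [int p = 0] (mod 3)" using m by (simp add: cong_def)
    ultimately show ?thesis using False unfolding Legendre_def QuadRes_def by auto
  qed
  have "Legendre (int p) (int 3) * Legendre (int 3) (int p) = (-1) ^ ((p - 1) div 2 * ((3 - 1) div 2))"
    by (rule Quadratic_Reciprocity) (use p in auto)
  then have QR: "Legendre (int p) 3 * Legendre 3 (int p) = (-1) ^ h"
    by (simp add: h_def)
  have "[Legendre 3 (int p) = 3 ^ h] (mod int p)"
    unfolding h_def using p by (intro euler_criterion) auto
  then have "[(-1) ^ h * Legendre 3 (int p) = (-1) ^ h * 3 ^ h] (mod int p)"
    by (rule cong_scalar_left)
  moreover have "(-1) ^ h * 3 ^ h = (-3 :: int) ^ h"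
    by (simp flip: power_mult_distrib)
  moreover have "(-1) ^ h * Legendre 3 (int p) = Legendre (int p) 3"
  proof -
    \<comment> \<open>The symbol is nonzero because its product with another one is a power of
      -1.\<close>
    have "Legendre 3 (int p) * Legendre 3 (int p) = 1"
      using QR by (auto simp: Legendre_def split: if_splits)
    then show ?thesis unfolding QR[symmetric] by (simp add: mult.assoc)
  qed
  ultimately have "[Legendre (int p) 3 = (-3) ^ h] (mod int p)"
    by (simp only:)
  then show ?thesis
    unfolding L3 h_def by (rule cong_sym)
qed

section \<open>The cubic congruence over the integers\<close>

text \<open>An even representative \<open>a = 2 b\<close> makes the Chebyshev argument \<open>1 - 27a/2\<close> an integer.\<close>

lemma cubic_root_int:
  fixes b :: int
  assumes p: "prime p" "p > 3" and L: "Legendre (2 * b * (4 - 27 * (2 * b))) (int p) = -1"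
  defines "S \<equiv> \<Sum>k = 0..p div 3. int ((3 * k) choose k) * (2 * b) ^ k"
  shows "[(27 * (2 * b) - 4) * S ^ 3 + 3 * S + 1 = 0] (mod int p)"
proof -
  define n where "n = p div 3"
  \<comment> \<open>Chosen so that 2(y - 1) = -27a and 2 + 2y = 4 - 27a for a = 2b.\<close>
  define y where "y = 1 - 27 * b"
  define h where "h = (p - 1) div 2"
  have odd: "odd p" using p prime_odd_nat by auto
  have SV: "[S = cheb_V y n] (mod int p)"
  proof -
    have "[S = (\<Sum>k = 0..n. int ((n + k) choose (2 * k)) * (-27) ^ k * (2 * b) ^ k)] (mod int p)"
      unfolding S_def n_def
      by (intro cong_sum cong_scalar_right choose_triple_cong p) auto
    also have "(\<Sum>k = 0..n. int ((n + k) choose (2 * k)) * (-27) ^ k * (2 * b) ^ k) =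
        (\<Sum>k\<le>n. int ((n + k) choose (2 * k)) * (- 54 * b) ^ k)"
    proof (intro sum.cong)
      fix k
      have "(-27) ^ k * (2 * b) ^ k = (- 54 * b) ^ k"
        unfolding power_mult_distrib[symmetric] by simp
      then show "int ((n + k) choose (2 * k)) * (-27) ^ k * (2 * b) ^ k =
          int ((n + k) choose (2 * k)) * (- 54 * b) ^ k"
        by (simp only: mult.assoc)
    qed auto
    also have "\<dots> = cheb_V y n"
      by (rule cheb_V_binomial[symmetric]) (simp add: y_def)
    finally show ?thesis .
  qed
  \<comment> \<open>Since 4(y^2 - 1) = -3 * 9 * c with c = a(4 - 27a), and 4 and 9 are squares prime
    to \<open>p\<close>, the character of y^2 - 1 is that of -3 times that of c, which is
    -1.\<close>
  have e: "[(y\<^sup>2 - 1) ^ h = (if p mod 3 = 1 then -1 else 1)] (mod int p)"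
  proof -
    define c where "c = 2 * b * (4 - 27 * (2 * b))"
    have sq: "[(int m)\<^sup>2 ^ h = 1] (mod int p)" if "\<not> p dvd m" for m
    proof -
      have "2 * h = p - 1" using odd by (auto simp: h_def elim!: oddE)
      then have "(int m)\<^sup>2 ^ h = int (m ^ (p - 1))" by (simp flip: power_mult)
      then show ?thesis using fermat_theorem[OF p(1) that] by (metis cong_int_iff of_nat_1)
    qed
    have small: "\<not> p dvd 2" "\<not> p dvd 3"
      using p by (auto dest: dvd_imp_le)
    have "4 * (y\<^sup>2 - 1) = -3 * 9 * c"
      by (simp add: y_def c_def power2_eq_square algebra_simps)
    then have *: "4 ^ h * (y\<^sup>2 - 1) ^ h = (-3) ^ h * 9 ^ h * c ^ h"
      by (simp only: flip: power_mult_distrib)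
    have "[1 * (y\<^sup>2 - 1) ^ h = 4 ^ h * (y\<^sup>2 - 1) ^ h] (mod int p)"
      using sq[OF small(1)] by (intro cong_scalar_right) (simp add: cong_sym)
    also note *
    also have "[(-3) ^ h * 9 ^ h * c ^ h = (if p mod 3 = 1 then 1 else -1) * 1 * (-1)] (mod int p)"
    proof (intro cong_mult)
      show "[(-3) ^ h = (if p mod 3 = 1 then 1 else -1 :: int)] (mod int p)"
        unfolding h_def by (rule minus_three_euler[OF p])
      show "[9 ^ h = 1] (mod int p)"
        using sq[OF small(2)] by simp
      show "[c ^ h = -1] (mod int p)"
        using euler_criterion[OF p(1), of c] p(2) L by (simp add: c_def h_def cong_sym)
    qed
    finally show ?thesis by (simp split: if_splits)
  qed
  \<comment> \<open>The sign of the character matches the index: it is -1 when 3n + 1 = p and 1 when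
    3n + 1 = p - 1.\<close>
  from prime_mod_3[OF p] have "[cheb_V y (3 * n + 1) = 1] (mod int p)"
  proof
    assume m: "p mod 3 = 1"
    then have "3 * n + 1 = p" unfolding n_def by presburger
    then show ?thesis using cheb_V_prime(1)[OF p(1) odd e[unfolded h_def]] m by simp
  next
    assume m: "p mod 3 = 2"
    then have "3 * n + 1 = p - 1" unfolding n_def by presburger
    then show ?thesis using cheb_V_prime(2)[OF p(1) odd e[unfolded h_def]] m by simp
  qed
  then have V: "[1 - cheb_V y (3 * n + 1) = 1 - 1] (mod int p)"
    by (intro cong_diff) auto
  have "[(27 * (2 * b) - 4) * S ^ 3 + 3 * S + 1 =
      (27 * (2 * b) - 4) * cheb_V y n ^ 3 + 3 * cheb_V y n + 1] (mod int p)"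
    by (intro cong_add cong_mult cong_pow SV cong_refl)
  \<comment> \<open>The leading coefficient is -(2 + 2y), so the triple angle formula
    applies.\<close>
  also have "(27 * (2 * b) - 4) * cheb_V y n ^ 3 + 3 * cheb_V y n + 1 = 1 - cheb_V y (3 * n + 1)"
    unfolding cheb_V_triple by (simp add: y_def algebra_simps)
  also note V
  finally show ?thesis by simp
qed

text \<open>If \<open>x\<close> and \<open>z\<close> were distinct roots, \<open>x\<close> would be
  a root of the quadratic left after dividing out X - z. The cubic would then split modulo
  \<open>p\<close> and its discriminant would be a square.\<close>

lemma cubic_root_unique_int:
  fixes a x z :: int
  assumes p: "prime p" "p > 3" and L: "Legendre (a * (4 - 27 * a)) (int p) = -1"
    and x: "[(27 * a - 4) * x ^ 3 + 3 * x + 1 = 0] (mod int p)"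
    and z: "[(27 * a - 4) * z ^ 3 + 3 * z + 1 = 0] (mod int p)"
  shows "[x = z] (mod int p)"
proof (rule ccontr)
  assume neq: "\<not> [x = z] (mod int p)"
  have pp: "prime (int p)" using p by simp
  define A where "A = 27 * a - 4"
  have fx: "int p dvd A * x ^ 3 + 3 * x + 1" and fz: "int p dvd A * z ^ 3 + 3 * z + 1"
    using x z by (simp_all add: A_def cong_0_iff)
  have "int p dvd (A * x ^ 3 + 3 * x + 1) - (A * z ^ 3 + 3 * z + 1)"
    using fx fz by (rule dvd_diff)
  also have "\<dots> = (x - z) * (A * (x\<^sup>2 + x * z + z\<^sup>2) + 3)"
    by Groebner_Basis.algebra
  finally have q: "int p dvd A * (x\<^sup>2 + x * z + z\<^sup>2) + 3"
    using neq pp prime_dvd_multD cong_iff_dvd_diff by blast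
  text \<open>The discriminant of the cubic is that of the quadratic cofactor times the square of the
    value of the cofactor at \<open>z\<close>.\<close>
  define s where "s = (2 * A * x + A * z) * (3 * A * z\<^sup>2 + 3)"
  \<comment> \<open>The first factor of \<open>s\<close> is the derivative of the cofactor at
    \<open>x\<close>; its square is the discriminant of the cofactor plus 4A times the value there.
    The last product is a multiple of the cubic at \<open>z\<close>.\<close>
  have "s\<^sup>2 - 27\<^sup>2 * (a * (4 - 27 * a)) =
     (A * (x\<^sup>2 + x * z + z\<^sup>2) + 3) * (4 * A * (3 * A * z\<^sup>2 + 3)\<^sup>2)
     - 27 * A\<^sup>2 * (A * z ^ 3 + 3 * z - 1) * (A * z ^ 3 + 3 * z + 1)"
    unfolding s_def A_def by Groebner_Basis.algebra
  moreover have "int p dvd \<dots>"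
    using q fz by (intro dvd_diff dvd_mult dvd_mult2) auto
  ultimately have s: "[s\<^sup>2 = 27\<^sup>2 * (a * (4 - 27 * a))] (mod int p)"
    by (metis cong_iff_dvd_diff)
  have "\<not> p dvd 3" using p by (auto dest: dvd_imp_le)
  then have "coprime 3 (int p)"
    using p(1) by (metis coprime_commute coprime_int_iff of_nat_numeral prime_imp_coprime)
  then have "coprime (3 ^ 3) (int p)" by (simp only: coprime_power_left_iff simp_thms)
  \<comment> \<open>With \<open>u\<close> inverse to 27, \<open>u * s\<close> is a square root of
    a(4 - 27a) modulo \<open>p\<close>.\<close>
  then obtain u where u: "[27 * u = 1] (mod int p)"
    using cong_solve_coprime_int[of 27 "int p"] by auto
  have "[(u * s)\<^sup>2 = u\<^sup>2 * (27\<^sup>2 * (a * (4 - 27 * a)))] (mod int p)"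
    unfolding power_mult_distrib using s by (rule cong_scalar_left)
  also have "u\<^sup>2 * (27\<^sup>2 * (a * (4 - 27 * a))) = (27 * u)\<^sup>2 * (a * (4 - 27 * a))"
    by Groebner_Basis.algebra
  also have "[\<dots> = 1\<^sup>2 * (a * (4 - 27 * a))] (mod int p)"
    by (intro cong_scalar_right cong_pow u)
  finally have "QuadRes (int p) (a * (4 - 27 * a))"
    unfolding QuadRes_def by auto
  then show False using L by (simp add: Legendre_def split: if_splits)
qed

section \<open>Transfer to rationals with denominator prime to \<open>p\<close>\<close>

lemma p_integers_of_int: "prime p \<Longrightarrow> of_int k \<in> p_integers p"
  unfolding p_integers_iff
  by (intro exI[of _ k] exI[of _ 1]) (auto dest: prime_gt_1_nat)

lemma p_integers_add:
  assumes "prime p" "x \<in> p_integers p" "y \<in> p_integers p"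
  shows "x + y \<in> p_integers p"
proof -
  obtain m d n e where "\<not> int p dvd d" "x = of_int m / of_int d" "\<not> int p dvd e" "y = of_int n / of_int e"
    using assms(2,3) unfolding p_integers_iff by blast
  moreover from this have "\<not> int p dvd d * e"
    using assms(1) by (simp add: prime_dvd_mult_iff)
  moreover from calculation have "d \<noteq> 0" "e \<noteq> 0" by auto
  with calculation have "x + y = of_int (m * e + n * d) / of_int (d * e)"
    by (simp add: field_simps)
  ultimately show ?thesis unfolding p_integers_iff by blast
qed

lemma p_integers_mult:
  assumes "prime p" "x \<in> p_integers p" "y \<in> p_integers p"
  shows "x * y \<in> p_integers p"
proof -
  obtain m d n e where "\<not> int p dvd d" "x = of_int m / of_int d" "\<not> int p dvd e" "y = of_int n / of_int e"
    using assms(2,3) unfolding p_integers_iff by blast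
  moreover from this have "\<not> int p dvd d * e"
    using assms(1) by (simp add: prime_dvd_mult_iff)
  moreover from calculation have "x * y = of_int (m * n) / of_int (d * e)"
    by simp
  ultimately show ?thesis unfolding p_integers_iff by blast
qed

lemma p_cong_refl: "prime p \<Longrightarrow> x \<in> p_integers p \<Longrightarrow> p_cong p x x"
  using p_integers_of_int[of p 0] by (auto simp: p_cong_def intro!: bexI[of _ 0])

lemma p_cong_sym:
  assumes "prime p" "p_cong p x y"
  shows "p_cong p y x"
proof -
  obtain t where t: "t \<in> p_integers p" "x - y = of_nat p * t"
    using assms(2) unfolding p_cong_def by blast
  have "of_int (-1) * t \<in> p_integers p"
    by (rule p_integers_mult[OF assms(1) p_integers_of_int[OF assms(1)] t(1)])
  moreover have "y - x = of_nat p * (of_int (-1) * t)" using t(2) by simp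
  ultimately show ?thesis using assms(2) unfolding p_cong_def by blast
qed

lemma p_cong_trans:
  assumes "prime p" "p_cong p x y" "p_cong p y z"
  shows "p_cong p x z"
proof -
  obtain t u where t: "t \<in> p_integers p" "x - y = of_nat p * t" "u \<in> p_integers p" "y - z = of_nat p * u"
    using assms(2,3) unfolding p_cong_def by blast
  then have "x - z = of_nat p * (t + u)" by (simp add: algebra_simps)
  then show ?thesis
    using assms t unfolding p_cong_def by (auto intro!: p_integers_add)
qed

lemma p_cong_add:
  assumes "prime p" "p_cong p x y" "p_cong p x' y'"
  shows "p_cong p (x + x') (y + y')"
proof -
  obtain t u where t: "t \<in> p_integers p" "x - y = of_nat p * t" "u \<in> p_integers p" "x' - y' = of_nat p * u"
    using assms(2,3) unfolding p_cong_def by blast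
  then have "x + x' - (y + y') = of_nat p * (t + u)" by (simp add: algebra_simps)
  then show ?thesis
    using assms t unfolding p_cong_def by (auto intro!: p_integers_add)
qed

lemma p_cong_mult:
  assumes "prime p" "p_cong p x y" "p_cong p x' y'"
  shows "p_cong p (x * x') (y * y')"
proof -
  obtain t u where t: "t \<in> p_integers p" "x - y = of_nat p * t" "u \<in> p_integers p" "x' - y' = of_nat p * u"
    using assms(2,3) unfolding p_cong_def by blast
  have "x * x' - y * y' = (x - y) * x' + y * (x' - y')" by (simp add: algebra_simps)
  also have "\<dots> = of_nat p * (t * x' + y * u)" unfolding t by (simp add: algebra_simps)
  finally have "x * x' - y * y' = of_nat p * (t * x' + y * u)" .
  then show ?thesis
    using assms t unfolding p_cong_def by (auto intro!: p_integers_add p_integers_mult)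
qed

lemma p_cong_of_int_refl: "prime p \<Longrightarrow> p_cong p (of_int k) (of_int k)"
  by (simp add: p_cong_refl p_integers_of_int)

lemma p_cong_power:
  assumes "prime p" "p_cong p x y"
  shows "p_cong p (x ^ n) (y ^ n)"
proof (induction n)
  case 0
  show ?case using p_cong_of_int_refl[OF assms(1), of 1] by simp
next
  case (Suc n)
  then show ?case unfolding power_Suc by (rule p_cong_mult[OF assms])
qed

lemma p_cong_sum:
  assumes "prime p" "\<And>i. i \<in> I \<Longrightarrow> p_cong p (f i) (g i)"
  shows "p_cong p (sum f I) (sum g I)"
proof -
  have 0: "p_cong p 0 0" using p_cong_of_int_refl[OF assms(1), of 0] by simp
  show ?thesis
    using assms(2)
    by (induction I rule: infinite_finite_induct) (auto simp: 0 intro!: p_cong_add[OF assms(1)])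
qed

text \<open>A denominator prime to \<open>p\<close> can be cancelled, so nothing new becomes
  congruent among integers.\<close>

lemma p_cong_of_int_iff:
  assumes "prime p"
  shows "p_cong p (of_int m) (of_int n) \<longleftrightarrow> [m = n] (mod int p)"
proof
  assume "p_cong p (of_int m) (of_int n)"
  then obtain t where t: "t \<in> p_integers p" "of_int m - of_int n = of_nat p * t"
    unfolding p_cong_def by blast
  then obtain k e where e: "\<not> int p dvd e" "t = of_int k / of_int e"
    unfolding p_integers_iff by blast
  then have "e \<noteq> 0" by auto
  with t e have "(of_int ((m - n) * e) :: rat) = of_int (int p * k)"
    by (simp add: field_simps)
  then have "(m - n) * e = int p * k" by (simp only: of_int_eq_iff)
  then have "int p dvd (m - n) * e" by simp
  then show "[m = n] (mod int p)"
    using e(1) assms by (simp add: prime_dvd_mult_iff cong_iff_dvd_diff)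
next
  assume "[m = n] (mod int p)"
  then obtain k where "m - n = int p * k"
    by (auto simp: cong_iff_dvd_diff)
  then have "of_int m - of_int n = (of_nat p * of_int k :: rat)"
    by (metis of_int_diff of_int_mult of_int_of_nat_eq)
  then show "p_cong p (of_int m) (of_int n)"
    unfolding p_cong_def using assms p_integers_of_int by blast
qed

lemma p_cong_p_residue:
  assumes "prime p" "r \<in> p_integers p"
  shows "p_cong p r (of_int (p_residue p r))"
  using theI'[OF p_residue_well_defined[OF assms]] unfolding p_residue_def by blast

lemma Legendre_cong:
  assumes "[m = n] (mod p)"
  shows "Legendre m p = Legendre n p"
proof -
  have "[z = m] (mod p) \<longleftrightarrow> [z = n] (mod p)" "[m = z] (mod p) \<longleftrightarrow> [n = z] (mod p)" for z
    using assms cong_trans cong_sym by blast+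
  then show ?thesis unfolding Legendre_def QuadRes_def by simp
qed

text \<open>Frees the symbol from the least residue, so that an even representative can be
  used.\<close>

lemma rat_Legendre_eq:
  assumes "prime p" "p_cong p r (of_int m)"
  shows "rat_Legendre r p = Legendre m (int p)"
proof -
  have "r \<in> p_integers p" using assms(2) by (simp add: p_cong_def)
  then have "p_cong p (of_int (p_residue p r)) (of_int m)"
    using assms p_cong_p_residue p_cong_sym p_cong_trans by blast
  then show ?thesis
    unfolding rat_Legendre_def by (intro Legendre_cong) (simp add: p_cong_of_int_iff[OF assms(1)])
qed

text \<open>Adding the odd number \<open>p\<close> changes the parity of a residue.\<close>

lemma p_cong_even_int:
  assumes "prime p" "odd p" "r \<in> p_integers p"
  obtains b where "p_cong p r (of_int (2 * b))"
proof -
  define m where "m = p_residue p r"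
  define m' where "m' = (if even m then m else m + int p)"
  have "even m'" using assms(2) by (simp add: m'_def)
  then obtain b where "m' = 2 * b" by blast
  moreover have "[m = m'] (mod int p)"
    by (simp add: m'_def cong_def)
  then have "p_cong p (of_int m) (of_int m')"
    using p_cong_of_int_iff[OF assms(1)] by blast
  then have "p_cong p r (of_int m')"
    using p_cong_p_residue[OF assms(1,3)] p_cong_trans assms(1) unfolding m_def by blast
  ultimately show thesis using that by blast
qed

lemma p_cong_cubic:
  assumes p: "prime p" and a: "p_cong p a (of_int \<alpha>)" and x: "p_cong p x (of_int \<xi>)"
  shows "p_cong p ((27 * a - 4) * x ^ 3 + 3 * x + 1) 0 \<longleftrightarrow>
    [(27 * \<alpha> - 4) * \<xi> ^ 3 + 3 * \<xi> + 1 = 0] (mod int p)"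
proof -
  note c = p_cong_of_int_refl[OF p]
  \<comment> \<open>Numerals and differences are written as sums and products of integer casts, so
    that the congruence rules match structurally.\<close>
  have "p_cong p ((of_int 27 * a + of_int (-4)) * x ^ 3 + of_int 3 * x + of_int 1)
      ((of_int 27 * of_int \<alpha> + of_int (-4)) * of_int \<xi> ^ 3 + of_int 3 * of_int \<xi> + of_int 1)"
    by (intro p_cong_add[OF p] p_cong_mult[OF p] p_cong_power[OF p] a x c)
  then have "p_cong p ((27 * a - 4) * x ^ 3 + 3 * x + 1)
      (of_int ((27 * \<alpha> - 4) * \<xi> ^ 3 + 3 * \<xi> + 1))"
    by simp
  then have "p_cong p ((27 * a - 4) * x ^ 3 + 3 * x + 1) 0 \<longleftrightarrow>
      p_cong p (of_int ((27 * \<alpha> - 4) * \<xi> ^ 3 + 3 * \<xi> + 1)) (of_int 0)"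
    using p_cong_trans[OF p] p_cong_sym[OF p] unfolding of_int_0 by blast
  then show ?thesis
    using p_cong_of_int_iff[OF p] by blast
qed

theorem theorem3p10:
  fixes p :: nat and a S :: rat
  assumes "prime p" and "p > 3"
    and "a \<in> p_integers p"
    and "rat_Legendre (a * (4 - 27 * a)) p = -1"
  defines "S \<equiv> (\<Sum>k = 0..p div 3. of_nat ((3 * k) choose k) * a ^ k)"
  shows "p_cong p ((27 * a - 4) * S ^ 3 + 3 * S + 1) 0 \<and>
    (\<forall>x \<in> p_integers p.
       p_cong p ((27 * a - 4) * x ^ 3 + 3 * x + 1) 0 \<longrightarrow> p_cong p x S)"
proof -
  note p = assms(1)
  note c = p_cong_of_int_refl[OF p]
  have "odd p" using assms prime_odd_nat by auto
  then obtain b where a: "p_cong p a (of_int (2 * b))"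
    using p_cong_even_int assms by blast
  define \<sigma> where "\<sigma> = (\<Sum>k = 0..p div 3. int ((3 * k) choose k) * (2 * b) ^ k)"
  have "p_cong p (\<Sum>k = 0..p div 3. of_int (int ((3 * k) choose k)) * a ^ k)
      (\<Sum>k = 0..p div 3. of_int (int ((3 * k) choose k)) * of_int (2 * b) ^ k)"
    by (intro p_cong_sum[OF p] p_cong_mult[OF p] p_cong_power[OF p] a c)
  then have S: "p_cong p S (of_int \<sigma>)"
    by (simp add: S_def \<sigma>_def)
  have "p_cong p (a * (of_int 4 + of_int (-27) * a))
      (of_int (2 * b) * (of_int 4 + of_int (-27) * of_int (2 * b)))"
    by (intro p_cong_add[OF p] p_cong_mult[OF p] a c)
  then have "p_cong p (a * (4 - 27 * a)) (of_int (2 * b * (4 - 27 * (2 * b))))"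
    by simp
  then have L: "Legendre (2 * b * (4 - 27 * (2 * b))) (int p) = -1"
    using rat_Legendre_eq[OF p] assms(4) by metis
  have root: "[(27 * (2 * b) - 4) * \<sigma> ^ 3 + 3 * \<sigma> + 1 = 0] (mod int p)"
    unfolding \<sigma>_def by (rule cubic_root_int[OF assms(1,2) L])
  show ?thesis
  proof (intro conjI ballI impI)
    show "p_cong p ((27 * a - 4) * S ^ 3 + 3 * S + 1) 0"
      using p_cong_cubic[OF p a S] root by blast
  next
    fix x
    assume "x \<in> p_integers p" and fx: "p_cong p ((27 * a - 4) * x ^ 3 + 3 * x + 1) 0"
    \<comment> \<open>The least residue of \<open>x\<close> brings uniqueness down to the
      integers.\<close>
    then have x: "p_cong p x (of_int (p_residue p x))"
      using p p_cong_p_residue by blast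
    with fx have "[p_residue p x = \<sigma>] (mod int p)"
      using p_cong_cubic[OF p a x] cubic_root_unique_int[OF assms(1,2) L _ root] by blast
    then have "p_cong p (of_int (p_residue p x)) (of_int \<sigma>)"
      by (simp add: p_cong_of_int_iff[OF p])
    then show "p_cong p x S"
      using x S p_cong_trans[OF p] p_cong_sym[OF p] by blast
  qed
qed

end
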